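(* Let $Q=\{t_{ij}\}$ and $Q'=\{t'_{ij}\}$ be choices of scalars for a KLR algebra associated to a simply-laced Kac–Moody algebra whose underlying graph $\Gamma$ is a tree. Fix a root $r\in I$ of the tree, and let $D_i\in\Bbbk^\times$ ($i\in I$) and the relation $<$ on $I$ (comparison of levels) be as defined in the context. Then, associated to this fixed choice of root, there is an algebra isomorphism $$\gimel\colon R_Q\longrightarrow R_{Q'}$$ which sends each idempotent $e(\mathbf{i})$ to $e(\mathbf{i})$, sends a dot on an $i$-labelled strand to $D_i$ times the dot, and sends a crossing whose bottom labels are $i$ (left) and $j$ (right) to $\gamma_{ij}$ times the same crossing; that is, $\gimel(x_ke(\mathbf{i}))=D_{i_k}x_ke(\mathbf{i})$ and $\gimel(\psi_ke(\mathbf{i}))=\gamma_{i_ki_{k+1}}\psi_ke(\mathbf{i})$, where $$\gamma_{ij}=\begin{cases}D_i^{-1}&\text{if }i=j,\\ t_{ji}(t'_{ji})^{-1}D_j&\text{if }i<j\text{ and }i\cdot j=-1,\\ t_{ij}(t'_{ij})^{-1}&\text{if }i<j\text{ and }i\cdot j=0,\\ 1&\text{otherwise.}\end{cases}$$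
   Context: $\Bbbk$ is a field. $I$ is the vertex set of a graph $\Gamma$ (underlying graph of a simply-laced Kac–Moody algebra): $i\cdot i=2$, and for $i\neq j$, $i\cdot j=j\cdot i\in\{0,-1\}$ with an edge between $i$ and $j$ iff $i\cdot j=-1$. A choice of scalars $Q$ is a family $t_{ij}\in\Bbbk^\times$ ($i\ne j$ in $I$) with $t_{ij}=t_{ji}$ when $i\cdot j=0$. **KLR algebra $R_Q$.** It consists of finite $\Bbbk$-linear combinations of braid-like diagrams with strands labelled by $I$ and carrying dots (product $ab$ = $a$ stacked on top of $b$), modulo local relations. Explicitly it is generated by $e(\mathbf{i})$, $x_ke(\mathbf{i})$ ($1\le k\le n$), $\psi_ke(\mathbf{i})$ ($1\le k<n$) for all finite sequences $\mathbf{i}=(i_1,\dots,i_n)\in I^n$, $n\ge0$ (vertical strands labelled $i_1,\dots,i_n$ from left to right, with respectively nothing, a dot on the $k$-th strand, a crossing of the $k$-th and $(k+1)$-st strands), where the $e(\mathbf{i})$ are orthogonal idempotents, $x_ke(\mathbf{i})=e(\mathbf{i})x_k$, $\psi_ke(\mathbf{i})=e(s_k\mathbf{i})\psi_k$ ($s_k$ swaps entries $k,k+1$), the $x$'s commute, $\psi_k\psi_l=\psi_l\psi_k$ for $|k-l|>1$, $\psi_kx_l=x_l\psi_k$ for $l\neq k,k+1$, and: - $\psi_k^2e(\mathbf{i})=0$ if $i_k=i_{k+1}$; $=t_{i_ki_{k+1}}e(\mathbf{i})$ if $i_k\cdot i_{k+1}=0$; $=(t_{i_ki_{k+1}}x_k+t_{i_{k+1}i_k}x_{k+1})e(\mathbf{i})$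 if $i_k\cdot i_{k+1}=-1$; - $(\psi_kx_k-x_{k+1}\psi_k)e(\mathbf{i})=(x_k\psi_k-\psi_kx_{k+1})e(\mathbf{i})=\delta_{i_k,i_{k+1}}e(\mathbf{i})$; - $(\psi_k\psi_{k+1}\psi_k-\psi_{k+1}\psi_k\psi_{k+1})e(\mathbf{i})=t_{i_ki_{k+1}}e(\mathbf{i})$ if $i_k=i_{k+2}$ and $i_k\cdot i_{k+1}=-1$, and $=0$ otherwise. **Tree data.** Suppose $\Gamma$ is a tree with chosen root $r\in I$; orient all edges away from $r$. For an edge $e$ let $s(e)$ be its source and $t(e)$ its target. The level of a vertex is its distance from $r$. Write $i<j$ if vertex $i$ occurs in a lower level than vertex $j$ (so distinct vertices of equal level are not related by $<$). Let $P_i$ be the unique directed path of edges from $r$ to $i$. Put $v_{ij}=t_{ij}^{-1}t_{ji}$ and $v'_{ij}=(t'_{ij})^{-1}t'_{ji}$, and $$D_i:=\prod_{e\in P_i}v'_{s(e)t(e)}\,v_{t(e)s(e)},$$ so $D_r=1$.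
   Formalization: The relation < in γ may order distinct vertices of equal level, and must order i, j one way whenever t_ij ≠ t'_ij; with such vertices unrelated, γ_ij = γ_ji = 1 and the relation ψ²e(i,j) = t_ij e(i,j) would not be preserved. *)

theory Defs
  imports Complex_Main "HOL-Library.Poly_Mapping" "Graph_Theory.Digraph_Component"
begin

section \<open>Associative algebras without unit\<close>

text \<open>
  The algebra \<open>R\<^sub>Q\<close> is only locally unital (there is one idempotent \<open>e(i)\<close> for each of the infinitely
  many sequences), so the unital ring records of HOL-Algebra do not apply.
\<close>

record ('k, 'a) nu_algebra =
  alg_carrier :: "'a set"
  alg_add :: "'a \<Rightarrow> 'a \<Rightarrow> 'a"
  alg_mult :: "'a \<Rightarrow> 'a \<Rightarrow> 'a"
  alg_smult :: "'k \<Rightarrow> 'a \<Rightarrow> 'a"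

definition algebra_iso ::
    "('k, 'a) nu_algebra \<Rightarrow> ('k, 'b) nu_algebra \<Rightarrow> ('a \<Rightarrow> 'b) \<Rightarrow> bool" where
  "algebra_iso A B f \<longleftrightarrow>
     bij_betw f (alg_carrier A) (alg_carrier B) \<and>
     (\<forall>a\<in>alg_carrier A. \<forall>b\<in>alg_carrier A. f (alg_add A a b) = alg_add B (f a) (f b)) \<and>
     (\<forall>a\<in>alg_carrier A. \<forall>b\<in>alg_carrier A. f (alg_mult A a b) = alg_mult B (f a) (f b)) \<and>
     (\<forall>c. \<forall>a\<in>alg_carrier A. f (alg_smult A c a) = alg_smult B c (f a))"

text \<open>
  Words form a monoid under concatenation, written additively because the multiplication of
  \<^typ>\<open>'a \<Rightarrow>\<^sub>0 'b\<close> is the convolution along the addition of \<^typ>\<open>'a\<close>. Hence \<open>'g word \<Rightarrow>\<^sub>0 'k\<close> is the free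
  unital algebra on \<^typ>\<open>'g\<close>.
\<close>

datatype 'g word = Word (letters: "'g list")

instantiation word :: (type) monoid_add
begin

definition zero_word :: "'a word" where
  "zero_word = Word []"

definition plus_word :: "'a word \<Rightarrow> 'a word \<Rightarrow> 'a word" where
  "plus_word u w = Word (letters u @ letters w)"

instance
  by standard (simp_all add: zero_word_def plus_word_def)

end

definition gen :: "'g \<Rightarrow> ('g word \<Rightarrow>\<^sub>0 'k::field)" where
  "gen g = Poly_Mapping.single (Word [g]) 1"

definition scale :: "'k \<Rightarrow> ('g word \<Rightarrow>\<^sub>0 'k) \<Rightarrow> ('g word \<Rightarrow>\<^sub>0 'k::field)" where
  "scale c a = Poly_Mapping.single 0 c * a"

text \<open>The free algebra without unit on the set \<open>G\<close>: no constant term.\<close>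

definition free_nu_algebra :: "'g set \<Rightarrow> ('g word \<Rightarrow>\<^sub>0 'k::field) set" where
  "free_nu_algebra G =
     {a. \<forall>w\<in>Poly_Mapping.keys a. letters w \<noteq> [] \<and> set (letters w) \<subseteq> G}"

text \<open>
  The two-sided ideal of \<open>A\<close> generated by \<open>S\<close>. Since \<open>A\<close> has no unit, closure under scalars is
  required separately.
\<close>

inductive_set gen_ideal ::
    "('g word \<Rightarrow>\<^sub>0 'k::field) set \<Rightarrow> ('g word \<Rightarrow>\<^sub>0 'k) set \<Rightarrow> ('g word \<Rightarrow>\<^sub>0 'k) set"
  for A S where
  zero: "0 \<in> gen_ideal A S"
| base: "s \<in> S \<Longrightarrow> s \<in> gen_ideal A S"
| add: "a \<in> gen_ideal A S \<Longrightarrow> b \<in> gen_ideal A S \<Longrightarrow> a + b \<in> gen_ideal A S"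
| smult: "a \<in> gen_ideal A S \<Longrightarrow> scale c a \<in> gen_ideal A S"
| left: "u \<in> A \<Longrightarrow> a \<in> gen_ideal A S \<Longrightarrow> u * a \<in> gen_ideal A S"
| right: "a \<in> gen_ideal A S \<Longrightarrow> u \<in> A \<Longrightarrow> a * u \<in> gen_ideal A S"

definition residue_class ::
    "('g word \<Rightarrow>\<^sub>0 'k::field) set \<Rightarrow> ('g word \<Rightarrow>\<^sub>0 'k) set \<Rightarrow> ('g word \<Rightarrow>\<^sub>0 'k) \<Rightarrow> ('g word \<Rightarrow>\<^sub>0 'k) set" where
  "residue_class A J a = {b \<in> A. b - a \<in> J}"

definition quotient_algebra ::
    "('g word \<Rightarrow>\<^sub>0 'k::field) set \<Rightarrow> ('g word \<Rightarrow>\<^sub>0 'k) set \<Rightarrow> ('k, ('g word \<Rightarrow>\<^sub>0 'k) set) nu_algebra" where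
  "quotient_algebra A J =
     \<lparr> alg_carrier = residue_class A J ` A,
       alg_add = (\<lambda>X Y. \<Union>a\<in>X. \<Union>b\<in>Y. residue_class A J (a + b)),
       alg_mult = (\<lambda>X Y. \<Union>a\<in>X. \<Union>b\<in>Y. residue_class A J (a * b)),
       alg_smult = (\<lambda>c X. \<Union>a\<in>X. residue_class A J (scale c a)) \<rparr>"


section \<open>Simply-laced data and KLR algebras\<close>

text \<open>The vertex set \<open>I\<close> is the type \<^typ>\<open>'i\<close>, and \<open>dot i j\<close> is \<open>i \<cdot> j\<close>.\<close>

definition simply_laced :: "('i \<Rightarrow> 'i \<Rightarrow> int) \<Rightarrow> bool" where
  "simply_laced dot \<longleftrightarrow>
     (\<forall>i. dot i i = 2) \<and>
     (\<forall>i j. i \<noteq> j \<longrightarrow> dot i j = dot j i \<and> dot i j \<in> {0, -1})"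

text \<open>The diagonal values \<open>t i i\<close> are irrelevant.\<close>

definition choice_of_scalars :: "('i \<Rightarrow> 'i \<Rightarrow> int) \<Rightarrow> ('i \<Rightarrow> 'i \<Rightarrow> 'k::field) \<Rightarrow> bool" where
  "choice_of_scalars dot t \<longleftrightarrow>
     (\<forall>i j. i \<noteq> j \<longrightarrow> t i j \<noteq> 0 \<and> (dot i j = 0 \<longrightarrow> t i j = t j i))"

text \<open>
  \<open>Idem is\<close>, \<open>Dot k is\<close>, \<open>Cross k is\<close> stand for \<open>e(is)\<close>, \<open>x\<^sub>k e(is)\<close>, \<open>\<psi>\<^sub>k e(is)\<close>, where \<open>is\<close> lists the labels at
  the bottom of the diagram. Strands are counted from \<open>0\<close>.
\<close>

datatype 'i klr_gen = Idem "'i list" | Dot nat "'i list" | Cross nat "'i list"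

definition klr_gens :: "'i klr_gen set" where
  "klr_gens = range Idem \<union> {Dot k is | k is. k < length is} \<union> {Cross k is | k is. Suc k < length is}"

abbreviation klr_free :: "('i klr_gen word \<Rightarrow>\<^sub>0 'k::field) set" where
  "klr_free \<equiv> free_nu_algebra klr_gens"

abbreviation idem :: "'i list \<Rightarrow> ('i klr_gen word \<Rightarrow>\<^sub>0 'k::field)" where
  "idem is \<equiv> gen (Idem is)"

abbreviation xdot :: "nat \<Rightarrow> 'i list \<Rightarrow> ('i klr_gen word \<Rightarrow>\<^sub>0 'k::field)" where
  "xdot k is \<equiv> gen (Dot k is)"

abbreviation psi :: "nat \<Rightarrow> 'i list \<Rightarrow> ('i klr_gen word \<Rightarrow>\<^sub>0 'k::field)" where
  "psi k is \<equiv> gen (Cross k is)"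

definition swap :: "nat \<Rightarrow> 'i list \<Rightarrow> 'i list" where
  "swap k is = is[k := is ! Suc k, Suc k := is ! k]"

text \<open>
  Each element is the difference of the two sides of a defining relation. A product \<open>a * b\<close> is \<open>a\<close>
  stacked on top of \<open>b\<close>, so in a product of generators each label list is the one reached from the
  bottom labels \<open>is\<close> by the crossings to its right.
\<close>

inductive_set klr_relations ::
    "('i \<Rightarrow> 'i \<Rightarrow> int) \<Rightarrow> ('i \<Rightarrow> 'i \<Rightarrow> 'k::field) \<Rightarrow> ('i klr_gen word \<Rightarrow>\<^sub>0 'k) set"
  for dot t where
  idem_idem: "idem is * idem js - (if is = js then idem is else 0) \<in> klr_relations dot t"
| dot_idem: "k < length is \<Longrightarrow> xdot k is * idem is - xdot k is \<in> klr_relations dot t"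
| idem_dot: "k < length is \<Longrightarrow> idem is * xdot k is - xdot k is \<in> klr_relations dot t"
| psi_idem: "Suc k < length is \<Longrightarrow> psi k is * idem is - psi k is \<in> klr_relations dot t"
| idem_psi: "Suc k < length is \<Longrightarrow> idem (swap k is) * psi k is - psi k is \<in> klr_relations dot t"
| dot_dot: "k < length is \<Longrightarrow> l < length is \<Longrightarrow>
    xdot k is * xdot l is - xdot l is * xdot k is \<in> klr_relations dot t"
| psi_psi_far: "Suc k < length is \<Longrightarrow> Suc l < length is \<Longrightarrow> Suc k < l \<or> Suc l < k \<Longrightarrow>
    psi k (swap l is) * psi l is - psi l (swap k is) * psi k is \<in> klr_relations dot t"
| psi_dot_far: "Suc k < length is \<Longrightarrow> l < length is \<Longrightarrow> l \<noteq> k \<Longrightarrow> l \<noteq> Suc k \<Longrightarrow>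
    psi k is * xdot l is - xdot l (swap k is) * psi k is \<in> klr_relations dot t"
| psi_sq: "Suc k < length is \<Longrightarrow>
    psi k (swap k is) * psi k is -
      (let i = is ! k; j = is ! Suc k in
       if i = j then 0
       else if dot i j = 0 then scale (t i j) (idem is)
       else scale (t i j) (xdot k is) + scale (t j i) (xdot (Suc k) is)) \<in> klr_relations dot t"
| psi_dot_left: "Suc k < length is \<Longrightarrow>
    psi k is * xdot k is - xdot (Suc k) (swap k is) * psi k is -
      (if is ! k = is ! Suc k then idem is else 0) \<in> klr_relations dot t"
| psi_dot_right: "Suc k < length is \<Longrightarrow>
    xdot k (swap k is) * psi k is - psi k is * xdot (Suc k) is -
      (if is ! k = is ! Suc k then idem is else 0) \<in> klr_relations dot t"
| braid: "Suc (Suc k) < length is \<Longrightarrow>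
    psi k (swap (Suc k) (swap k is)) * psi (Suc k) (swap k is) * psi k is -
    psi (Suc k) (swap k (swap (Suc k) is)) * psi k (swap (Suc k) is) * psi (Suc k) is -
      (if is ! k = is ! Suc (Suc k) \<and> dot (is ! k) (is ! Suc k) = -1
       then scale (t (is ! k) (is ! Suc k)) (idem is) else 0) \<in> klr_relations dot t"

definition klr_ideal ::
    "('i \<Rightarrow> 'i \<Rightarrow> int) \<Rightarrow> ('i \<Rightarrow> 'i \<Rightarrow> 'k::field) \<Rightarrow> ('i klr_gen word \<Rightarrow>\<^sub>0 'k) set" where
  "klr_ideal dot t = gen_ideal klr_free (klr_relations dot t)"

definition KLR ::
    "('i \<Rightarrow> 'i \<Rightarrow> int) \<Rightarrow> ('i \<Rightarrow> 'i \<Rightarrow> 'k::field) \<Rightarrow> ('k, ('i klr_gen word \<Rightarrow>\<^sub>0 'k) set) nu_algebra" where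
  "KLR dot t = quotient_algebra klr_free (klr_ideal dot t)"

definition klr_class ::
    "('i \<Rightarrow> 'i \<Rightarrow> int) \<Rightarrow> ('i \<Rightarrow> 'i \<Rightarrow> 'k::field) \<Rightarrow> ('i klr_gen word \<Rightarrow>\<^sub>0 'k) \<Rightarrow> ('i klr_gen word \<Rightarrow>\<^sub>0 'k) set" where
  "klr_class dot t a = residue_class klr_free (klr_ideal dot t) a"


section \<open>Tree data\<close>

text \<open>A simple graph is represented by its symmetric digraph; an edge is a pair of opposite arcs.\<close>

definition diagram :: "('i \<Rightarrow> 'i \<Rightarrow> int) \<Rightarrow> ('i, 'i \<times> 'i) pre_digraph" where
  "diagram dot = with_proj \<lparr> pverts = UNIV, parcs = {(i, j). i \<noteq> j \<and> dot i j = -1} \<rparr>"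

text \<open>
  In a symmetric digraph an edge traversed back and forth is a \<^const>\<open>pre_digraph.cycle\<close> of length \<open>2\<close>,
  so \<^const>\<open>tree\<close> of Graph_Theory is not the undirected notion. A cycle of length at least \<open>3\<close> is a cycle of the
  undirected graph.
\<close>

definition undirected_tree :: "('v, 'e) pre_digraph \<Rightarrow> bool" where
  "undirected_tree G \<longleftrightarrow> connected G \<and> \<not> (\<exists>p. pre_digraph.cycle G p \<and> 3 \<le> length p)"

definition level :: "('i \<Rightarrow> 'i \<Rightarrow> int) \<Rightarrow> 'i \<Rightarrow> 'i \<Rightarrow> nat" where
  "level dot r i = (LEAST n. \<exists>p. pre_digraph.awalk (diagram dot) r p i \<and> length p = n)"

definition oriented_diagram :: "('i \<Rightarrow> 'i \<Rightarrow> int) \<Rightarrow> 'i \<Rightarrow> ('i, 'i \<times> 'i) pre_digraph" where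
  "oriented_diagram dot r = with_proj
     \<lparr> pverts = UNIV,
       parcs = {(i, j). i \<noteq> j \<and> dot i j = -1 \<and> level dot r i < level dot r j} \<rparr>"

definition root_path :: "('i \<Rightarrow> 'i \<Rightarrow> int) \<Rightarrow> 'i \<Rightarrow> 'i \<Rightarrow> ('i \<times> 'i) list" where
  "root_path dot r i = (THE p. pre_digraph.awalk (oriented_diagram dot r) r p i)"

definition ratio :: "('i \<Rightarrow> 'i \<Rightarrow> 'k::field) \<Rightarrow> 'i \<Rightarrow> 'i \<Rightarrow> 'k" where
  "ratio t i j = inverse (t i j) * t j i"

definition dot_scalar ::
    "('i \<Rightarrow> 'i \<Rightarrow> int) \<Rightarrow> ('i \<Rightarrow> 'i \<Rightarrow> 'k::field) \<Rightarrow> ('i \<Rightarrow> 'i \<Rightarrow> 'k) \<Rightarrow> 'i \<Rightarrow> 'i \<Rightarrow> 'k" where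
  "dot_scalar dot t t' r i =
     (\<Prod>(a, b)\<leftarrow>root_path dot r i. ratio t' a b * ratio t b a)"

definition level_less :: "('i \<Rightarrow> 'i \<Rightarrow> int) \<Rightarrow> 'i \<Rightarrow> 'i \<Rightarrow> 'i \<Rightarrow> bool" where
  "level_less dot r i j \<longleftrightarrow> level dot r i < level dot r j"

text \<open>
  The relation \<open><\<close> used in \<open>\<gamma>\<close> is comparison of levels, except that ties have to be broken between
  those \<open>i \<noteq> j\<close> of equal level for which \<open>t\<^sub>i\<^sub>j \<noteq> t'\<^sub>i\<^sub>j\<close>. Such \<open>i, j\<close> satisfy \<open>i \<cdot> j = 0\<close> in a tree, and leaving
  them unrelated would give \<open>\<gamma>\<^sub>i\<^sub>j = \<gamma>\<^sub>j\<^sub>i = 1\<close>. Then \<open>\<psi>\<^sub>1\<^sup>2 e(i,j) = t\<^sub>i\<^sub>j e(i,j)\<close> in the source would force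
  \<open>t'\<^sub>i\<^sub>j e(i,j) = t\<^sub>i\<^sub>j e(i,j)\<close> in the target, which fails because \<open>e(i,j) \<noteq> 0\<close> there.
\<close>

definition level_order ::
    "('i \<Rightarrow> 'i \<Rightarrow> int) \<Rightarrow> ('i \<Rightarrow> 'i \<Rightarrow> 'k::field) \<Rightarrow> ('i \<Rightarrow> 'i \<Rightarrow> 'k) \<Rightarrow> 'i \<Rightarrow> ('i \<Rightarrow> 'i \<Rightarrow> bool) \<Rightarrow> bool" where
  "level_order dot t t' r lt \<longleftrightarrow>
     (\<forall>i j. level dot r i \<noteq> level dot r j \<longrightarrow> lt i j = level_less dot r i j) \<and>
     (\<forall>i j. i \<noteq> j \<and> level dot r i = level dot r j \<and> t i j \<noteq> t' i j \<longrightarrow> lt i j = (\<not> lt j i))"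

lemma level_order_level_less_iff:
  "level_order dot t t' r (level_less dot r) \<longleftrightarrow>
     (\<forall>i j. i \<noteq> j \<and> level dot r i = level dot r j \<longrightarrow> t i j = t' i j)"
  unfolding level_order_def level_less_def by auto

definition crossing_scalar ::
    "('i \<Rightarrow> 'i \<Rightarrow> int) \<Rightarrow> ('i \<Rightarrow> 'i \<Rightarrow> 'k::field) \<Rightarrow> ('i \<Rightarrow> 'i \<Rightarrow> 'k) \<Rightarrow> 'i \<Rightarrow> ('i \<Rightarrow> 'i \<Rightarrow> bool) \<Rightarrow> 'i \<Rightarrow> 'i \<Rightarrow> 'k" where
  "crossing_scalar dot t t' r lt i j =
     (if i = j then inverse (dot_scalar dot t t' r i)
      else if lt i j \<and> dot i j = -1 then t j i * inverse (t' j i) * dot_scalar dot t t' r j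
      else if lt i j \<and> dot i j = 0 then t i j * inverse (t' i j)
      else 1)"

end

theory Submission
  imports Defs
begin

text \<open>
  Multiplying every dot and crossing by a nonzero scalar is an automorphism of the free algebra. It
  takes each defining relation for \<open>t\<close> to a multiple of the corresponding one for \<open>t'\<close> as soon as
  \<open>\<gamma>\<^sub>i\<^sub>i D\<^sub>i = 1\<close>, and for \<open>i \<noteq> j\<close> the product \<open>\<gamma>\<^sub>i\<^sub>j \<gamma>\<^sub>j\<^sub>i t'\<^sub>i\<^sub>j\<close> equals \<open>t\<^sub>i\<^sub>j\<close> if \<open>i \<cdot> j = 0\<close> and
  \<open>t\<^sub>i\<^sub>j D\<^sub>i\<close> if \<open>i \<cdot> j = -1\<close>. These conditions are preserved by inverting \<open>D\<close> and \<open>\<gamma>\<close> and exchanging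
  \<open>t\<close> and \<open>t'\<close>, so the automorphism matches the two ideals. In a tree adjacent vertices have
  different levels and each vertex has at most one neighbour of smaller level, so the root path of a
  vertex extends that of its parent by one edge; this recursion for \<open>D\<close> gives the conditions.
\<close>

section \<open>Free algebras and their quotients\<close>

text \<open>Reduces additive statements to monomials: updating \<open>f\<close> at a key outside its
  support adds a monomial, and the zero map is the monomial with coefficient 0.\<close>

lemma poly_mapping_add_induct [case_names single add]:
  assumes single: "\<And>k v. P (Poly_Mapping.single k v)"
    and add: "\<And>a b. P a \<Longrightarrow> P b \<Longrightarrow> P (a + b)"
  shows "P (a :: 'w \<Rightarrow>\<^sub>0 'b::monoid_add)"
proof (induction a rule: Poly_Mapping.update_induct)
  case const
  show ?case
    using single[of undefined 0] by simp
next
  case (update f k v)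
  have "Poly_Mapping.update k v f = f + Poly_Mapping.single k v"
    using update(1)
    by (intro poly_mapping_eqI) (auto simp: lookup_update lookup_add lookup_single when_def in_keys_iff)
  with update show ?case
    by (simp add: add single)
qed

section \<open>Scalar multiplication in the free algebra\<close>

lemma lookup_scale: "Poly_Mapping.lookup (scale c a) w = c * Poly_Mapping.lookup a w"
  unfolding scale_def mult_map_scale_conv_mult[symmetric] by (simp add: Poly_Mapping.map.rep_eq when_def)

lemma scale_add: "scale c (a + b) = scale c a + scale c b"
  by (rule poly_mapping_eqI) (simp add: lookup_scale lookup_add algebra_simps)

lemma scale_diff: "scale c (a - b) = scale c a - scale c b"
  by (rule poly_mapping_eqI) (simp add: lookup_scale lookup_minus algebra_simps)

lemma scale_scale [simp]: "scale c (scale d a) = scale (c * d) a"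
  by (rule poly_mapping_eqI) (simp add: lookup_scale)

lemma scale_1 [simp]: "scale 1 a = a"
  by (rule poly_mapping_eqI) (simp add: lookup_scale)

lemma scale_0_right [simp]: "scale c 0 = 0"
  by (rule poly_mapping_eqI) (simp add: lookup_scale)

lemma scale_minus_1: "scale (-1) a = - a"
  by (rule poly_mapping_eqI) (simp add: lookup_scale)

lemma scale_mult_left [simp]: "scale c a * b = scale c (a * b)"
  by (simp add: scale_def mult.assoc)

text \<open>Scalars are central because the empty word is neutral on both sides and the coefficients
  commute.\<close>

lemma scale_mult_right [simp]: "a * scale c b = scale c (a * b)"
proof -
  have "a * Poly_Mapping.single 0 c = Poly_Mapping.single 0 c * a"
    by (induction a rule: poly_mapping_add_induct) (simp_all add: mult_single algebra_simps)
  then show ?thesis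
    unfolding scale_def by (metis mult.assoc)
qed

text \<open>The algebra endomorphism \<open>g\<close> \<mapsto> \<open>c g\<close> \<cdot>
  \<open>g\<close>. It is diagonal in the basis of words, so its linearity and its inverse can be
  read off coefficient by coefficient.\<close>

definition rescale :: "('g \<Rightarrow> 'k) \<Rightarrow> ('g word \<Rightarrow>\<^sub>0 'k) \<Rightarrow> ('g word \<Rightarrow>\<^sub>0 'k::field)" where
  "rescale c a = Poly_Mapping.mapp (\<lambda>w x. (\<Prod>g\<leftarrow>letters w. c g) * x) a"

lemma lookup_rescale:
  "Poly_Mapping.lookup (rescale c a) w = (\<Prod>g\<leftarrow>letters w. c g) * Poly_Mapping.lookup a w"
  by (simp add: rescale_def lookup_mapp when_def in_keys_iff)

lemma rescale_add: "rescale c (a + b) = rescale c a + rescale c b"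
  by (rule poly_mapping_eqI) (simp add: lookup_rescale lookup_add algebra_simps)

lemma rescale_diff: "rescale c (a - b) = rescale c a - rescale c b"
  by (rule poly_mapping_eqI) (simp add: lookup_rescale lookup_minus algebra_simps)

lemma rescale_0: "rescale c 0 = 0"
  by (rule poly_mapping_eqI) (simp add: lookup_rescale)

lemma rescale_scale: "rescale c (scale k a) = scale k (rescale c a)"
  by (rule poly_mapping_eqI) (simp add: lookup_rescale lookup_scale)

lemma rescale_single:
  "rescale c (Poly_Mapping.single w x) = Poly_Mapping.single w ((\<Prod>g\<leftarrow>letters w. c g) * x)"
  by (rule poly_mapping_eqI) (simp add: lookup_rescale lookup_single when_def)

lemma rescale_gen: "rescale c (gen g) = scale (c g) (gen g)"
  by (simp add: gen_def rescale_single scale_def mult_single)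

text \<open>The weight of a word is a product over its letters, hence multiplicative under
  concatenation; bilinearity extends this from monomials.\<close>

lemma rescale_mult: "rescale c (a * b) = rescale c a * rescale c b"
proof (induction a rule: poly_mapping_add_induct)
  case (single u x)
  show ?case
    by (induction b rule: poly_mapping_add_induct)
      (simp_all add: rescale_single rescale_add mult_single plus_word_def algebra_simps)
qed (simp add: rescale_add algebra_simps)

lemma rescale_rescale_inverse:
  assumes "\<And>g. c g * d g = 1"
  shows "rescale c (rescale d a) = a"
proof -
  have "(\<Prod>g\<leftarrow>gs. c g) * (\<Prod>g\<leftarrow>gs. d g) = 1" for gs
    using assms by (induction gs) (simp_all add: mult.left_commute mult.assoc[symmetric])
  then show ?thesis
    by (intro poly_mapping_eqI) (simp add: lookup_rescale mult.assoc[symmetric])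
qed

lemma rescale_free_nu_algebra: "a \<in> free_nu_algebra G \<Longrightarrow> rescale c a \<in> free_nu_algebra G"
  unfolding free_nu_algebra_def rescale_def by (auto dest!: subsetD[OF keys_mapp_subset])

lemma rescale_gen_ideal:
  assumes "a \<in> gen_ideal (free_nu_algebra G) S"
    and "\<And>s. s \<in> S \<Longrightarrow> rescale c s \<in> gen_ideal (free_nu_algebra G) S'"
  shows "rescale c a \<in> gen_ideal (free_nu_algebra G) S'"
  using assms(1)
proof induction
  case (base s)
  then show ?case
    by (rule assms(2))
qed (simp_all add: rescale_0 rescale_add rescale_scale rescale_mult rescale_free_nu_algebra gen_ideal.intros)

section \<open>Ideals and residue classes\<close>

lemma gen_ideal_diff:
  "a \<in> gen_ideal A S \<Longrightarrow> b \<in> gen_ideal A S \<Longrightarrow> a - b \<in> gen_ideal A S"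
  using gen_ideal.add[of a A S "scale (-1) b"] gen_ideal.smult[of b A S "-1"]
  by (simp add: scale_minus_1)

lemma residue_class_cong:
  assumes "a - b \<in> gen_ideal A S"
  shows "residue_class A (gen_ideal A S) a = residue_class A (gen_ideal A S) b"
proof -
  have "c - a \<in> gen_ideal A S \<longleftrightarrow> c - b \<in> gen_ideal A S" for c
    using gen_ideal.add[OF _ assms, of "c - a"] gen_ideal_diff[OF _ assms, of "c - b"] by auto
  then show ?thesis
    by (simp add: residue_class_def)
qed

lemma smult_residue_class:
  assumes "a \<in> A"
  shows "alg_smult (quotient_algebra A (gen_ideal A S)) c (residue_class A (gen_ideal A S) a) =
    residue_class A (gen_ideal A S) (scale c a)"
proof -
  have "a \<in> residue_class A (gen_ideal A S) a"
    using assms by (simp add: residue_class_def gen_ideal.zero)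
  moreover have "residue_class A (gen_ideal A S) (scale c b) = residue_class A (gen_ideal A S) (scale c a)"
    if "b \<in> residue_class A (gen_ideal A S) a" for b
  proof (rule residue_class_cong)
    show "scale c b - scale c a \<in> gen_ideal A S"
      using that unfolding scale_diff[symmetric] residue_class_def by (auto intro: gen_ideal.smult)
  qed
  \<comment> \<open>All members of the union coincide, and the index set contains \<open>a\<close>,
    so the union is that common class.\<close>
  ultimately have "(\<Union>b\<in>residue_class A (gen_ideal A S) a. residue_class A (gen_ideal A S) (scale c b)) =
      residue_class A (gen_ideal A S) (scale c a)"
    by (metis (no_types, lifting) SUP_eq_const empty_iff)
  then show ?thesis
    by (simp add: quotient_algebra_def)
qed

lemma image_residue_class:
  assumes "inj f" "\<And>a b. f (a - b) = f a - f b"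
  shows "f ` residue_class A J a = residue_class (f ` A) (f ` J) (f a)"
proof -
  have "f b - f a \<in> f ` J \<longleftrightarrow> b - a \<in> J" for b
    by (metis assms inj_image_mem_iff)
  then show ?thesis
    by (auto simp: residue_class_def)
qed

text \<open>The operations on classes are unions over representatives, so they commute with images.\<close>

lemma algebra_iso_image:
  assumes "inj f"
    and add: "\<And>a b. f (a + b) = f a + f b" and diff: "\<And>a b. f (a - b) = f a - f b"
    and mult: "\<And>a b. f (a * b) = f a * f b" and scale: "\<And>c a. f (scale c a) = scale c (f a)"
  shows "algebra_iso (quotient_algebra A J) (quotient_algebra (f ` A) (f ` J)) (image f)"
proof -
  note image_class = image_residue_class[of f, OF \<open>inj f\<close> diff]
  have "bij_betw (image f) (residue_class A J ` A) (residue_class (f ` A) (f ` J) ` f ` A)"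
    unfolding bij_betw_def
    by (auto simp: image_image image_class inj_on_def inj_image_eq_iff[OF \<open>inj f\<close>])
  then show ?thesis
    unfolding algebra_iso_def quotient_algebra_def
    by (simp add: image_UN image_class add mult scale)
qed

section \<open>Rescaling KLR relations\<close>

definition klr_weight :: "('i \<Rightarrow> 'k) \<Rightarrow> ('i \<Rightarrow> 'i \<Rightarrow> 'k) \<Rightarrow> 'i klr_gen \<Rightarrow> 'k::field" where
  "klr_weight D \<gamma> g = (case g of Idem is \<Rightarrow> 1 | Dot k is \<Rightarrow> D (is ! k)
     | Cross k is \<Rightarrow> \<gamma> (is ! k) (is ! Suc k))"

lemma klr_weight_simps [simp]:
  "klr_weight D \<gamma> (Idem is) = 1"
  "klr_weight D \<gamma> (Dot k is) = D (is ! k)"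
  "klr_weight D \<gamma> (Cross k is) = \<gamma> (is ! k) (is ! Suc k)"
  by (simp_all add: klr_weight_def)

text \<open>For adjacent labels only \<open>D i\<close> occurs; exchanging \<open>i\<close> and
  \<open>j\<close> gives the condition for the other dot coefficient. Nonvanishing makes the
  rescaling invertible.\<close>

definition compatible_scalars ::
    "('i \<Rightarrow> 'i \<Rightarrow> int) \<Rightarrow> ('i \<Rightarrow> 'i \<Rightarrow> 'k::field) \<Rightarrow> ('i \<Rightarrow> 'i \<Rightarrow> 'k) \<Rightarrow> ('i \<Rightarrow> 'k) \<Rightarrow> ('i \<Rightarrow> 'i \<Rightarrow> 'k) \<Rightarrow> bool"
  where
  "compatible_scalars dot t t' D \<gamma> \<longleftrightarrow>
     (\<forall>i. D i \<noteq> 0 \<and> \<gamma> i i * D i = 1) \<and> (\<forall>i j. \<gamma> i j \<noteq> 0) \<and>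
     (\<forall>i j. i \<noteq> j \<longrightarrow> \<gamma> i j * \<gamma> j i * t' i j = (if dot i j = 0 then t i j else t i j * D i))"

lemma length_swap [simp]: "length (swap k is) = length is"
  by (simp add: swap_def)

lemma nth_swap:
  "Suc k < length is \<Longrightarrow> swap k is ! l = (if l = k then is ! Suc k else if l = Suc k then is ! k else is ! l)"
  by (simp add: swap_def nth_list_update)

text \<open>The factor \<open>c\<close> is the weight of the leading products of the relation. Dots
  and crossings are weighted by strand labels, so sliding them does not change it; compatibility
  accounts for the lower-order terms.\<close>

lemma rescale_klr_relation:
  assumes sl: "simply_laced dot" and comp: "compatible_scalars dot t t' D \<gamma>"
    and "s \<in> klr_relations dot t"
  shows "\<exists>c. \<exists>s'\<in>klr_relations dot t'. rescale (klr_weight D \<gamma>) s = scale c s'"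
proof -
  note rescale_simps = rescale_diff rescale_add rescale_mult rescale_scale rescale_gen rescale_0
    scale_add scale_diff nth_swap mult.commute mult.left_commute
  have same: "\<gamma> i i * D i = 1" for i
    using comp by (simp add: compatible_scalars_def)
  have far: "\<gamma> i j * \<gamma> j i * t' i j = t i j" if "i \<noteq> j" "dot i j = 0" for i j
    using comp that by (simp add: compatible_scalars_def)
  have near: "\<gamma> i j * \<gamma> j i * t' i j = t i j * D i" if "i \<noteq> j" "dot i j \<noteq> 0" for i j
    using comp that by (simp add: compatible_scalars_def)
  from assms(3) show ?thesis
  proof cases
    case (idem_idem "is" js)
    show ?thesis
      by (intro exI[of _ 1] bexI[OF _ klr_relations.idem_idem[of "is" js]]) (auto simp: idem_idem rescale_simps)
  next
    case (dot_idem k "is")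
    then show ?thesis
      by (intro exI[of _ "D (is ! k)"] bexI[OF _ klr_relations.dot_idem[of k "is"]]) (simp_all add: rescale_simps)
  next
    case (idem_dot k "is")
    then show ?thesis
      by (intro exI[of _ "D (is ! k)"] bexI[OF _ klr_relations.idem_dot[of k "is"]]) (simp_all add: rescale_simps)
  next
    case (psi_idem k "is")
    then show ?thesis
      by (intro exI[of _ "\<gamma> (is ! k) (is ! Suc k)"] bexI[OF _ klr_relations.psi_idem[of k "is"]]) (simp_all add: rescale_simps)
  next
    case (idem_psi k "is")
    then show ?thesis
      by (intro exI[of _ "\<gamma> (is ! k) (is ! Suc k)"] bexI[OF _ klr_relations.idem_psi[of k "is"]]) (simp_all add: rescale_simps)
  next
    case (dot_dot k "is" l)
    then show ?thesis
      by (intro exI[of _ "D (is ! k) * D (is ! l)"] bexI[OF _ klr_relations.dot_dot[of k "is" l]]) (simp_all add: rescale_simps)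
  next
    case (psi_psi_far k "is" l)
    then show ?thesis
      by (intro exI[of _ "\<gamma> (is ! k) (is ! Suc k) * \<gamma> (is ! l) (is ! Suc l)"]
          bexI[OF _ klr_relations.psi_psi_far[of k "is" l]]) (auto simp: rescale_simps)
  next
    case (psi_dot_far k "is" l)
    then show ?thesis
      by (intro exI[of _ "\<gamma> (is ! k) (is ! Suc k) * D (is ! l)"]
          bexI[OF _ klr_relations.psi_dot_far[of k "is" l]]) (simp_all add: rescale_simps)
  next
    case (psi_sq k "is")
    \<comment> \<open>The lower crossing has bottom labels \<open>i, j\<close> and the upper one
      \<open>j, i\<close>. The two dot terms carry \<open>D i\<close> and \<open>D j\<close>, so the
      condition is needed for both orders of the labels.\<close>
    define i j where "i = is ! k" and "j = is ! Suc k"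
    have "dot j i = dot i j"
      using sl by (metis simply_laced_def)
    then have "\<gamma> i j * \<gamma> j i * t' i j = (if dot i j = 0 then t i j else t i j * D i)"
      "\<gamma> i j * \<gamma> j i * t' j i = (if dot i j = 0 then t j i else t j i * D j)" if "i \<noteq> j"
      using far[of i j] near[of i j] far[of j i] near[of j i] that by (auto simp: mult.commute mult.left_commute)
    with psi_sq show ?thesis
      by (intro exI[of _ "\<gamma> i j * \<gamma> j i"] bexI[OF _ klr_relations.psi_sq[of k "is"]])
        (auto simp: i_def[symmetric] j_def[symmetric] Let_def rescale_simps)
  next
    case (psi_dot_left k "is")
    then show ?thesis
      using same[of "is ! k"]
      by (intro exI[of _ "\<gamma> (is ! k) (is ! Suc k) * D (is ! k)"]
          bexI[OF _ klr_relations.psi_dot_left[of k "is"]]) (auto simp: rescale_simps)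
  next
    case (psi_dot_right k "is")
    then show ?thesis
      using same[of "is ! k"]
      by (intro exI[of _ "\<gamma> (is ! k) (is ! Suc k) * D (is ! Suc k)"]
          bexI[OF _ klr_relations.psi_dot_right[of k "is"]]) (auto simp: rescale_simps)
  next
    case (braid k "is")
    \<comment> \<open>Both triple products cross each of the pairs \<open>(i, j)\<close>,
      \<open>(i, l)\<close>, \<open>(j, l)\<close> once. The correction term arises only for
      \<open>l = i\<close>, and then \<gamma>\<open>i i\<close> cancels the \<open>D i\<close>
      coming from the adjacent pair.\<close>
    define i j l where "i = is ! k" and "j = is ! Suc k" and "l = is ! Suc (Suc k)"
    have "\<gamma> i j * \<gamma> i i * \<gamma> j i * t' i j = t i j" if "dot i j = -1"
    proof -
      have "i \<noteq> j"
        using that sl by (auto simp: simply_laced_def)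
      then have "\<gamma> i j * \<gamma> j i * t' i j = t i j * D i"
        using near that by simp
      then have "\<gamma> i j * \<gamma> i i * \<gamma> j i * t' i j = t i j * (\<gamma> i i * D i)"
        by (metis mult.commute mult.left_commute)
      then show ?thesis
        by (simp add: same)
    qed
    with braid show ?thesis
      by (intro exI[of _ "\<gamma> i j * \<gamma> i l * \<gamma> j l"] bexI[OF _ klr_relations.braid[of k "is"]])
        (auto simp: i_def[symmetric] j_def[symmetric] l_def[symmetric] rescale_simps)
  qed
qed

section \<open>From compatible scalars to an isomorphism\<close>

lemma rescale_klr_ideal:
  assumes "simply_laced dot" "compatible_scalars dot t t' D \<gamma>" "a \<in> klr_ideal dot t"
  shows "rescale (klr_weight D \<gamma>) a \<in> klr_ideal dot t'"
  using assms(3) unfolding klr_ideal_def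
proof (rule rescale_gen_ideal)
  fix s
  assume "s \<in> klr_relations dot t"
  then obtain c s' where "s' \<in> klr_relations dot t'" "rescale (klr_weight D \<gamma>) s = scale c s'"
    using rescale_klr_relation[OF assms(1,2)] by blast
  then show "rescale (klr_weight D \<gamma>) s \<in> gen_ideal klr_free (klr_relations dot t')"
    by (simp add: gen_ideal.base gen_ideal.smult)
qed

lemma compatible_scalars_inverse:
  assumes "compatible_scalars dot t t' D \<gamma>"
  shows "compatible_scalars dot t' t (\<lambda>i. inverse (D i)) (\<lambda>i j. inverse (\<gamma> i j))"
proof -
  have D: "D i \<noteq> 0" and \<gamma>: "\<gamma> i j \<noteq> 0" and "\<gamma> i i * D i = 1" for i j
    using assms by (auto simp: compatible_scalars_def)
  then have "inverse (\<gamma> i i) * inverse (D i) = 1" for i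
    by (metis inverse_1 inverse_mult_distrib)
  moreover have "inverse (\<gamma> i j) * inverse (\<gamma> j i) * t i j =
      (if dot i j = 0 then t' i j else t' i j * inverse (D i))" if "i \<noteq> j" for i j
  proof -
    have "\<gamma> i j * \<gamma> j i * t' i j = (if dot i j = 0 then t i j else t i j * D i)"
      using assms that by (simp add: compatible_scalars_def)
    then show ?thesis
      using D[of i] \<gamma>[of i j] \<gamma>[of j i] by (simp add: field_simps split: if_splits)
  qed
  ultimately show ?thesis
    using D \<gamma> by (simp add: compatible_scalars_def)
qed

lemma KLR_iso_of_compatible_scalars:
  assumes sl: "simply_laced dot" and comp: "compatible_scalars dot t t' D \<gamma>"
  defines "f \<equiv> rescale (klr_weight D \<gamma>)"
  shows "algebra_iso (KLR dot t) (KLR dot t') (image f)"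
    and "f ` klr_class dot t a = klr_class dot t' (f a)"
proof -
  let ?g = "rescale (klr_weight (\<lambda>i. inverse (D i)) (\<lambda>i j. inverse (\<gamma> i j)))"
  have "klr_weight D \<gamma> x * klr_weight (\<lambda>i. inverse (D i)) (\<lambda>i j. inverse (\<gamma> i j)) x = 1" for x
    using comp by (cases x) (auto simp: compatible_scalars_def)
  then have fg: "f (?g x) = x" and gf: "?g (f x) = x" for x
    unfolding f_def by (simp_all add: rescale_rescale_inverse mult.commute)
  then have inj: "inj f"
    by (metis injI)
  have image_eq: "f ` A = B" if "\<And>a. a \<in> A \<Longrightarrow> f a \<in> B" "\<And>b. b \<in> B \<Longrightarrow> ?g b \<in> A" for A B
  proof
    show "B \<subseteq> f ` A"
      by (rule subsetI, rule image_eqI, rule fg[symmetric]) (rule that(2))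
  qed (use that(1) in blast)
  have free: "f ` klr_free = klr_free"
    unfolding f_def by (rule image_eq[unfolded f_def]; rule rescale_free_nu_algebra)
  \<comment> \<open>The inverse rescaling belongs to the inverted scalars with \<open>t\<close> and
    \<open>t'\<close> exchanged, which gives the reverse inclusion.\<close>
  have ideal: "f ` klr_ideal dot t = klr_ideal dot t'"
    using rescale_klr_ideal[OF sl comp] rescale_klr_ideal[OF sl compatible_scalars_inverse[OF comp]]
    unfolding f_def by (rule image_eq[unfolded f_def])
  show "algebra_iso (KLR dot t) (KLR dot t') (image f)"
    using algebra_iso_image[of f klr_free "klr_ideal dot t"] inj
    unfolding KLR_def free ideal
    by (simp add: f_def rescale_add rescale_diff rescale_mult rescale_scale)
  show "f ` klr_class dot t a = klr_class dot t' (f a)"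
    using image_residue_class[of f klr_free "klr_ideal dot t"] inj
    unfolding klr_class_def free ideal by (simp add: f_def rescale_diff)
qed

lemma smult_klr_class:
  "g \<in> klr_gens \<Longrightarrow> alg_smult (KLR dot t) c (klr_class dot t (gen g)) = klr_class dot t (scale c (gen g))"
  unfolding KLR_def klr_class_def klr_ideal_def
  by (intro smult_residue_class) (simp add: free_nu_algebra_def gen_def)

section \<open>Levels in a tree\<close>

locale rooted_tree_diagram =
  fixes dot :: "'i \<Rightarrow> 'i \<Rightarrow> int" and r :: 'i
  assumes simply_laced: "simply_laced dot"
    and undirected_tree: "undirected_tree (diagram dot)"
begin

abbreviation adjacent :: "'i \<Rightarrow> 'i \<Rightarrow> bool" where
  "adjacent i j \<equiv> i \<noteq> j \<and> dot i j = -1"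

abbreviation depth :: "'i \<Rightarrow> nat" where
  "depth \<equiv> level dot r"

section \<open>Walks and distances from the root\<close>

lemma adjacent_sym: "adjacent i j \<Longrightarrow> adjacent j i"
  using simply_laced unfolding simply_laced_def by metis

sublocale wf_digraph "diagram dot"
  by unfold_locales (auto simp: diagram_def)

sublocale oriented: wf_digraph "oriented_diagram dot r"
  by unfold_locales (auto simp: oriented_diagram_def)

lemma diagram_simps [simp]:
  "verts (diagram dot) = UNIV"
  "(i, j) \<in> arcs (diagram dot) \<longleftrightarrow> adjacent i j"
  "tail (diagram dot) = fst"
  "head (diagram dot) = snd"
  by (auto simp: diagram_def)

lemma oriented_diagram_simps [simp]:
  "verts (oriented_diagram dot r) = UNIV"
  "(i, j) \<in> arcs (oriented_diagram dot r) \<longleftrightarrow> adjacent i j \<and> depth i < depth j"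
  "tail (oriented_diagram dot r) = fst"
  "head (oriented_diagram dot r) = snd"
  by (auto simp: oriented_diagram_def)

text \<open>Walks are split at their last arc because the inductions below pass from a vertex to its
  parent.\<close>

lemma awalk_snoc_iff: "awalk u (p @ [(a, b)]) v \<longleftrightarrow> awalk u p a \<and> adjacent a b \<and> v = b"
  by (induction p arbitrary: u) (auto simp: awalk_simps)

lemma oriented_awalk_snoc_iff:
  "oriented.awalk u (p @ [(a, b)]) v \<longleftrightarrow>
     oriented.awalk u p a \<and> adjacent a b \<and> depth a < depth b \<and> v = b"
  by (induction p arbitrary: u) (auto simp: oriented.awalk_simps)

lemma ex_awalk: "\<exists>p. awalk r p i"
proof -
  have "symmetric (diagram dot)"
    unfolding symmetric_def by (rule symI) (simp add: diagram_def, metis adjacent_sym)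
  then have "strongly_connected (diagram dot)"
    using undirected_tree symmetric_connected_imp_strongly_connected
    unfolding undirected_tree_def by blast
  then show ?thesis
    by (auto simp: strongly_connected_def reachable_awalk)
qed

lemma depth_le: "awalk r p i \<Longrightarrow> depth i \<le> length p"
  unfolding level_def by (rule Least_le) blast

lemma ex_awalk_depth: "\<exists>p. awalk r p i \<and> length p = depth i"
  unfolding level_def by (rule LeastI_ex) (use ex_awalk in blast)

lemma depth_root [simp]: "depth r = 0"
  using depth_le[of "[]" r] by (simp add: awalk_simps)

lemma depth_eq_0_iff: "depth i = 0 \<longleftrightarrow> i = r"
  using ex_awalk_depth[of i] by (auto simp: awalk_simps)

lemma depth_adjacent_le: "adjacent i j \<Longrightarrow> depth j \<le> Suc (depth i)"
  using ex_awalk_depth[of i] depth_le awalk_snoc_iff by (metis length_append_singleton)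

text \<open>The parent is the penultimate vertex of a shortest walk from the root.\<close>

lemma ex_parent:
  assumes "depth j = Suc n"
  obtains i where "adjacent i j" "depth i = n"
proof -
  obtain p where p: "awalk r p j" "length p = Suc n"
    using ex_awalk_depth[of j] assms by auto
  then obtain q a b where q: "p = q @ [(a, b)]"
    by (metis length_0_conv nat.distinct(1) rev_exhaust surj_pair)
  then have "adjacent a j" "awalk r q a" "length q = n"
    using p by (auto simp: awalk_snoc_iff)
  \<comment> \<open>The initial segment bounds the depth of \<open>a\<close> above; the last arc
    bounds it below.\<close>
  then have "depth a = n"
    using depth_le[of q a] depth_adjacent_le[of a j] assms by simp
  with \<open>adjacent a j\<close> show ?thesis
    using that by blast
qed

text \<open>Climb from both vertices to parents until these meet. The depth bound keeps the new end
  vertices off the path between the parents; the length bound ensures that closing the path up gives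
  a cycle of length at least 3.\<close>

lemma ex_apath_same_depth:
  assumes "a \<noteq> b" "depth a = n" "depth b = n"
  shows "\<exists>p. apath a p b \<and> 2 \<le> length p \<and> (\<forall>v\<in>set (awalk_verts a p). depth v \<le> n)"
  using assms
proof (induction n arbitrary: a b)
  case 0
  then show ?case by (simp add: depth_eq_0_iff)
next
  case (Suc n)
  obtain a' where a': "adjacent a a'" "depth a' = n"
    using ex_parent[OF Suc.prems(2)] adjacent_sym by metis
  obtain b' where b': "adjacent b' b" "depth b' = n"
    using ex_parent[OF Suc.prems(3)] by metis
  show ?case
  proof (cases "a' = b'")
    case True
    with a' b' Suc.prems show ?thesis
      by (intro exI[of _ "[(a, a'), (a', b)]"]) (auto simp: apath_def awalk_simps)
  next
    case False
    then obtain p where p: "apath a' p b'" "\<And>v. v \<in> set (awalk_verts a' p) \<Longrightarrow> depth v \<le> n"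
      using Suc.IH a' b' by blast
    let ?q = "(a, a') # p @ [(b', b)]"
    have walk: "awalk a' (p @ [(b', b)]) b"
      using p(1) b' by (simp add: apath_def awalk_snoc_iff del: awalk_append_iff)
    have "awlast a' p = b'"
      using p(1) by (auto simp: apath_def)
    then have verts: "awalk_verts a ?q = a # awalk_verts a' p @ [b]"
      using awalk_verts_append[OF walk] by simp
    have "distinct (awalk_verts a ?q)"
      unfolding verts using p Suc.prems by (fastforce simp: apath_def)
    moreover have "awalk a ?q b"
      using walk a' by (simp add: awalk_Cons_iff del: awalk_append_iff)
    moreover have "2 \<le> length ?q"
      by simp
    moreover have "\<forall>v\<in>set (awalk_verts a ?q). depth v \<le> Suc n"
      unfolding verts using p(2) Suc.prems by (auto intro: le_SucI)
    ultimately show ?thesis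
      unfolding apath_def by blast
  qed
qed

section \<open>Consequences of acyclicity\<close>

lemma no_long_cycle: "cycle p \<Longrightarrow> length p < 3"
  using undirected_tree unfolding undirected_tree_def by (meson not_le)

text \<open>An edge within a level would close a path of length at least 2 between its ends into a
  forbidden cycle.\<close>

lemma adjacent_depth_neq:
  assumes "adjacent i j"
  shows "depth i \<noteq> depth j"
proof
  assume "depth i = depth j"
  then obtain p where p: "apath i p j" "2 \<le> length p"
    using ex_apath_same_depth assms by blast
  have walk: "awalk i (p @ [(j, i)]) i"
    using p(1) adjacent_sym[OF assms] by (simp add: apath_def awalk_snoc_iff del: awalk_append_iff)
  have last: "awlast i p = j" and hd: "awhd i p = i" and dist: "distinct (awalk_verts i p)"
    using p(1) by (auto simp: apath_def)
  have "awalk_verts i p = i # tl (awalk_verts i p)"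
    using hd by (metis awalk_verts_non_Nil list.collapse)
  \<comment> \<open>The tail of the vertex list of the closed walk is a rotation of the distinct
    list of vertices of \<open>p\<close>.\<close>
  with dist have "distinct (tl (awalk_verts i p) @ [i])"
    by (metis distinct.simps(2) distinct1_rotate rotate1.simps(2))
  then have "distinct (tl (awalk_verts i (p @ [(j, i)])))"
    using awalk_verts_append[OF walk] last by simp
  with walk have "cycle (p @ [(j, i)])"
    unfolding cycle_def by blast
  with p(2) show False
    using no_long_cycle by fastforce
qed

text \<open>Two lower neighbours would lie on one level, joined by a path that stays at or below
  their depth and so avoids \<open>j\<close>; adding \<open>j\<close> gives a forbidden
  cycle.\<close>

lemma parent_unique:
  assumes "adjacent a j" "adjacent b j" "depth a < depth j" "depth b < depth j"
  shows "a = b"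
proof (rule ccontr)
  assume "a \<noteq> b"
  moreover have "depth a = depth b" "Suc (depth a) = depth j"
    using assms depth_adjacent_le[of a j] depth_adjacent_le[of b j] by simp_all
  ultimately obtain p where p: "apath a p b" "2 \<le> length p"
    "\<And>v. v \<in> set (awalk_verts a p) \<Longrightarrow> depth v \<le> depth a"
    using ex_apath_same_depth[of a b "depth a"] by metis
  let ?q = "(j, a) # p @ [(b, j)]"
  have walk: "awalk a (p @ [(b, j)]) j"
    using p(1) assms by (simp add: apath_def awalk_snoc_iff del: awalk_append_iff)
  have "awlast a p = b"
    using p(1) by (auto simp: apath_def)
  then have "distinct (tl (awalk_verts j ?q))"
    using awalk_verts_append[OF walk] p(1,3) \<open>Suc (depth a) = depth j\<close>
    by (fastforce simp: apath_def)
  moreover have "awalk j ?q j"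
    using walk adjacent_sym[OF assms(1)] by (simp add: awalk_Cons_iff del: awalk_append_iff)
  ultimately have "cycle ?q"
    unfolding cycle_def by blast
  with p(2) show False
    using no_long_cycle by fastforce
qed

text \<open>Justifies the definite description in \<open>root_path\<close>: an oriented walk to a
  non-root vertex must end with the arc from its unique parent.\<close>

lemma ex1_oriented_awalk: "\<exists>!p. oriented.awalk r p i"
proof (induction "depth i" arbitrary: i)
  case 0
  then have "i = r"
    by (simp add: depth_eq_0_iff)
  \<comment> \<open>A last arc into the root would start at a depth below 0.\<close>
  have "p = []" if "oriented.awalk r p r" for p
    using that by (cases p rule: rev_cases) (auto simp: oriented_awalk_snoc_iff simp del: oriented.awalk_append_iff)
  then show ?case
    unfolding \<open>i = r\<close> by (intro ex1I[of _ "[]"]) (auto simp: oriented.awalk_simps)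
next
  case (Suc n)
  obtain a where a: "adjacent a i" "depth a = n"
    using ex_parent Suc.hyps(2) by metis
  obtain p where p: "oriented.awalk r p a" and uniq: "\<And>q. oriented.awalk r q a \<Longrightarrow> q = p"
    using Suc.hyps(1) a(2) by blast
  show ?case
  proof (rule ex1I)
    show "oriented.awalk r (p @ [(a, i)]) i"
      using p a Suc.hyps(2) by (simp add: oriented_awalk_snoc_iff del: oriented.awalk_append_iff)
  next
    fix q assume q: "oriented.awalk r q i"
    have "q \<noteq> []"
      using q Suc.hyps(2) by (auto simp: oriented.awalk_simps)
    then obtain q' b where q': "q = q' @ [(b, i)]" "oriented.awalk r q' b" "adjacent b i" "depth b < depth i"
      using q by (cases q rule: rev_cases) (auto simp: oriented_awalk_snoc_iff simp del: oriented.awalk_append_iff)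
    moreover have "b = a"
      using parent_unique q' a Suc.hyps(2) by (metis lessI)
    ultimately show "q = p @ [(a, i)]"
      using uniq by blast
  qed
qed

section \<open>Root paths and the scalars \<open>D\<close> and \<gamma>\<close>

lemma root_path_eq: "oriented.awalk r p i \<Longrightarrow> root_path dot r i = p"
  unfolding root_path_def using ex1_oriented_awalk by (rule the1_equality)

lemma root_path_adjacent:
  assumes "adjacent i j" "depth i < depth j"
  shows "root_path dot r j = root_path dot r i @ [(i, j)]"
proof -
  obtain p where p: "oriented.awalk r p i"
    using ex1_oriented_awalk by blast
  with assms show ?thesis
    by (simp add: root_path_eq oriented_awalk_snoc_iff del: oriented.awalk_append_iff)
qed

lemma dot_scalar_adjacent:
  assumes "adjacent i j" "depth i < depth j"
  shows "dot_scalar dot t t' r j = dot_scalar dot t t' r i * (ratio t' i j * ratio t j i)"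
  using root_path_adjacent[OF assms] by (simp add: dot_scalar_def)

lemma dot_scalar_nonzero:
  assumes "choice_of_scalars dot t" "choice_of_scalars dot t'"
  shows "dot_scalar dot t t' r i \<noteq> 0"
proof -
  obtain p where p: "oriented.awalk r p i"
    using ex1_oriented_awalk by blast
  then have "set (root_path dot r i) \<subseteq> arcs (oriented_diagram dot r)"
    by (simp add: root_path_eq oriented.awalk_def)
  \<comment> \<open>Only off-diagonal scalars are known to be nonzero.\<close>
  then have "a \<noteq> b" if "(a, b) \<in> set (root_path dot r i)" for a b
    using that by auto
  then have "ratio t' a b * ratio t b a \<noteq> 0" if "(a, b) \<in> set (root_path dot r i)" for a b
    using that assms unfolding choice_of_scalars_def ratio_def
    by (metis mult_eq_0_iff nonzero_imp_inverse_nonzero)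
  then show ?thesis
    unfolding dot_scalar_def prod_list_zero_iff by auto
qed

lemma compatible_crossing_scalar:
  assumes t: "choice_of_scalars dot t" and t': "choice_of_scalars dot t'"
    and lt: "level_order dot t t' r lt"
  shows "compatible_scalars dot t t' (dot_scalar dot t t' r) (crossing_scalar dot t t' r lt)"
proof -
  let ?D = "dot_scalar dot t t' r" and ?\<gamma> = "crossing_scalar dot t t' r lt"
  have D: "?D i \<noteq> 0" for i
    using dot_scalar_nonzero t t' by blast
  have t_nonzero: "t i j \<noteq> 0" "t' i j \<noteq> 0" if "i \<noteq> j" for i j
    using t t' that by (auto simp: choice_of_scalars_def)
  have "?\<gamma> i j \<noteq> 0" for i j
    using D t_nonzero[of i j] t_nonzero[of j i] by (auto simp: crossing_scalar_def)
  moreover have "?\<gamma> i i * ?D i = 1" for i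
    using D by (simp add: crossing_scalar_def)
  moreover have "?\<gamma> i j * ?\<gamma> j i * t' i j = (if dot i j = 0 then t i j else t i j * ?D i)"
    if "i \<noteq> j" for i j
  proof (cases "dot i j = 0")
    case True
    then have "dot j i = 0" "t j i = t i j" "t' j i = t' i j"
      using simply_laced t t' that unfolding simply_laced_def choice_of_scalars_def by metis+
    \<comment> \<open>If \<open>t i j\<close> and \<open>t' i j\<close> differ, exactly one of the
      two crossings carries their quotient; if they agree, both crossing scalars are 1.\<close>
    moreover have "lt i j = (\<not> lt j i)" if "t i j \<noteq> t' i j"
      using lt that \<open>i \<noteq> j\<close> unfolding level_order_def level_less_def by (metis not_less_iff_gr_or_eq)
    ultimately show ?thesis
      using that True t_nonzero[of i j]
      by (cases "t i j = t' i j") (auto simp: crossing_scalar_def)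
  next
    case False
    then have adj: "adjacent i j"
      using simply_laced that by (auto simp: simply_laced_def)
    then have adj': "adjacent j i"
      by (rule adjacent_sym)
    consider "depth i < depth j" | "depth j < depth i"
      using adjacent_depth_neq[OF adj] by linarith
    then show ?thesis
    proof cases
      \<comment> \<open>Here \<gamma>\<open>i j\<close> contains \<open>D j\<close>, which the
        recursion along the edge expresses through \<open>D i\<close>. In the other case
        \<gamma>\<open>j i\<close> contains \<open>D i\<close> directly.\<close>
      case 1
      then have "lt i j" "\<not> lt j i"
        using lt by (auto simp: level_order_def level_less_def)
      then show ?thesis
        using adj adj' t_nonzero[of i j] t_nonzero[of j i] dot_scalar_adjacent[OF adj 1, of t t']
        by (simp add: crossing_scalar_def ratio_def field_simps)
    next
      case 2
      then have "lt j i" "\<not> lt i j"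
        using lt by (auto simp: level_order_def level_less_def)
      then show ?thesis
        using adj adj' t_nonzero[of i j] by (simp add: crossing_scalar_def)
    qed
  qed
  ultimately show ?thesis
    using D by (simp add: compatible_scalars_def)
qed

end

theorem proposition3p4:
  fixes dot :: "'i \<Rightarrow> 'i \<Rightarrow> int"
    and t t' :: "'i \<Rightarrow> 'i \<Rightarrow> 'k::field"
    and r :: 'i
    and lt :: "'i \<Rightarrow> 'i \<Rightarrow> bool"
  assumes "simply_laced dot"
    and "undirected_tree (diagram dot)"
    and "choice_of_scalars dot t"
    and "choice_of_scalars dot t'"
    and "level_order dot t t' r lt"
  shows "\<exists>\<phi>. algebra_iso (KLR dot t) (KLR dot t') \<phi> \<and>
    (\<forall>is. \<phi> (klr_class dot t (idem is)) = klr_class dot t' (idem is)) \<and>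
    (\<forall>is k. k < length is \<longrightarrow>
       \<phi> (klr_class dot t (xdot k is)) =
         alg_smult (KLR dot t') (dot_scalar dot t t' r (is ! k)) (klr_class dot t' (xdot k is))) \<and>
    (\<forall>is k. Suc k < length is \<longrightarrow>
       \<phi> (klr_class dot t (psi k is)) =
         alg_smult (KLR dot t') (crossing_scalar dot t t' r lt (is ! k) (is ! Suc k))
           (klr_class dot t' (psi k is)))"
proof -
  interpret rooted_tree_diagram dot r
    using assms by unfold_locales
  let ?D = "dot_scalar dot t t' r" and ?\<gamma> = "crossing_scalar dot t t' r lt"
  let ?f = "rescale (klr_weight ?D ?\<gamma>)"
  note iso = KLR_iso_of_compatible_scalars[OF simply_laced compatible_crossing_scalar[OF assms(3-5)]]
  show ?thesis
    \<comment> \<open>Elements of the quotient are residue classes, that is sets, so the isomorphism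
      is the image map of the rescaling.\<close>
    by (intro exI[of _ "image ?f"] conjI allI impI iso(1))
      (simp_all add: iso(2) rescale_gen smult_klr_class klr_gens_def)
qed

end
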